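(* There exists a bounded, continuous, nowhere differentiable, periodic function $G$ with period $1$ such that $$S(N) = \sqrt{N}\,G(\log_4 N).$$
   Context: For an integer $n\ge 0$, let $\mathrm{inv}_2(n)$ denote the number of inversions in the binary representation of $n$, i.e. the number of occurrences of $10$ as a scattered (not necessarily contiguous) subsequence: if $a_0a_1\cdots a_\ell$ is the binary representation of $n$ (most significant digit first), $\mathrm{inv}_2(n)$ is the number of pairs $j<j'$ with $a_j=1$, $a_{j'}=0$. Define $i_n=(-1)^{\mathrm{inv}_2(n)}$ for $n\ge 0$. The summatory function $S(N)$ of the sequence $(i_n)_{n\ge 0}$ is defined by $S(N)=\sum_{0\le n\le N} i_n$ (the upper limit $N$ is included).
   Formalization: As printed, with S(N) including n = N, the formula fails: S(1)=2 and S(4)=3 would force G(0)=2 and G(1)=3/2, against period 1. The formal statement proves S(N)=√N·G(log_4 N)+i_N for all N ≥ 1, i.e. the printed formula for the sum over 0 ≤ n < N. *)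

theory Defs
  imports "HOL-Analysis.Analysis"
begin

text \<open>Most significant digit first; 0 is represented by the single digit 0.\<close>

fun binary_digits :: "nat \<Rightarrow> nat list" where
  "binary_digits n = (if n < 2 then [n] else binary_digits (n div 2) @ [n mod 2])"

declare binary_digits.simps [simp del]

definition inv2 :: "nat \<Rightarrow> nat" where
  "inv2 n = card {(j, j'). j < j' \<and> j' < length (binary_digits n)
                      \<and> binary_digits n ! j = 1 \<and> binary_digits n ! j' = 0}"

definition inv_sign :: "nat \<Rightarrow> int" where
  "inv_sign n = (-1) ^ inv2 n"

definition S :: "nat \<Rightarrow> int" where
  "S N = (\<Sum>n = 0..N. inv_sign n)"

text \<open>
  Since the sum defining S includes its upper limit, \<open>S (4 * N) = 2 * S N - inv_sign N\<close>. Hence the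
  formula \<open>S N = sqrt N * G (log 4 N)\<close> cannot hold exactly with a function G of period 1; it is
  the sum over \<open>n < N\<close>, namely \<open>S N - inv_sign N\<close>, that scales exactly. The lemma
  \<open>no_exact_periodic_formula\<close> below records the failure, already visible at N = 1 and N = 4.
\<close>

lemma S_1: "S 1 = 2" and S_4: "S 4 = 3"
proof -
  have d: "binary_digits 0 = [0]" "binary_digits 1 = [1]" "binary_digits 2 = [1,0]"
    "binary_digits 3 = [1,1]" "binary_digits 4 = [1,0,0]"
    by (simp_all add: binary_digits.simps)
  have "{(j, j'). j < j' \<and> j' < length (binary_digits n)
      \<and> binary_digits n ! j = 1 \<and> binary_digits n ! j' = 0} = {}" if "n \<in> {0, 1, 3}" for n
    using that d by (auto simp: less_Suc_eq)
  from arg_cong[OF this, of _ card] have "inv2 n = 0" if "n \<in> {0, 1, 3}" for n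
    unfolding inv2_def using that by simp
  then have "inv2 0 = 0" "inv2 1 = 0" "inv2 3 = 0"
    by blast+
  moreover have "{(j, j'). j < j' \<and> j' < length (binary_digits 2)
      \<and> binary_digits 2 ! j = 1 \<and> binary_digits 2 ! j' = 0} = {(0, 1)}"
    by (auto simp: d less_Suc_eq)
  then have "inv2 2 = 1"
    by (simp add: inv2_def)
  moreover have "{(j, j'). j < j' \<and> j' < length (binary_digits 4)
      \<and> binary_digits 4 ! j = 1 \<and> binary_digits 4 ! j' = 0} = {(0, 1), (0, 2)}"
    by (auto simp: d less_Suc_eq)
  then have "inv2 4 = 2"
    by (simp add: inv2_def)
  moreover have "{0..1} = {0, 1::nat}" "{0..4} = {0, 1, 2, 3, 4::nat}"
    by auto
  ultimately show "S 1 = 2" "S 4 = 3"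
    unfolding S_def inv_sign_def by simp_all
qed

lemma no_exact_periodic_formula:
  "\<not> (\<exists>G :: real \<Rightarrow> real. (\<forall>x. G (x + 1) = G x) \<and>
        (\<forall>N\<ge>1. real_of_int (S N) = sqrt (real N) * G (log 4 (real N))))"
proof
  assume "\<exists>G :: real \<Rightarrow> real. (\<forall>x. G (x + 1) = G x) \<and>
        (\<forall>N\<ge>1. real_of_int (S N) = sqrt (real N) * G (log 4 (real N)))"
  then obtain G :: "real \<Rightarrow> real" where per: "\<And>x. G (x + 1) = G x"
    and eq: "\<And>N. N \<ge> 1 \<Longrightarrow> real_of_int (S N) = sqrt (real N) * G (log 4 (real N))"
    by blast
  have "G 0 = 2"
    using eq[of 1] S_1 by simp
  moreover have "2 * G 1 = 3"
    using eq[of 4] S_4 by simp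
  ultimately show False
    using per[of 0] by simp
qed

end

theory Submission
  imports Defs
begin

text \<open>
  The four terms with indices \<open>4 * n, \<dots>, 4 * n + 3\<close> of the sequence sum to twice its \<open>n\<close>-th term,
  so the partial sums \<open>T\<close> satisfy \<open>T (4 * N) = 2 * T N\<close>. Therefore \<open>T \<lfloor>4 ^ k * x\<rfloor> / 2 ^ k\<close>
  converges uniformly to a continuous \<open>F\<close> that extends \<open>T\<close> and has \<open>F (4 * x) = 2 * F x\<close>; take
  \<open>G y = F (4 powr y) / 2 powr y\<close>. The increment of \<open>F\<close> over an interval
  \<open>[n / 4 ^ k, (n + 1) / 4 ^ k]\<close> is \<open>\<plusminus> 1 / 2 ^ k\<close>, so the difference quotients straddling any
  point are unbounded.
\<close>

section \<open>Signs under appending binary digits\<close>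

definition inversions :: "nat list \<Rightarrow> nat" where
  "inversions xs = card {(j, j'). j < j' \<and> j' < length xs \<and> xs ! j = 1 \<and> xs ! j' = 0}"

lemma inv2_eq_inversions: "inv2 n = inversions (binary_digits n)"
  by (simp add: inv2_def inversions_def)

lemma inversions_singleton [simp]: "inversions [b] = 0"
proof -
  have "{(j, j'). j < j' \<and> j' < length [b] \<and> [b] ! j = 1 \<and> [b] ! j' = 0} = {}"
    by auto
  then show ?thesis
    unfolding inversions_def by (simp only: card.empty)
qed

text \<open>A new last digit can only be the right member of an inversion, and a 0 there forms one
  with every earlier 1.\<close>

lemma inversions_snoc:
  "inversions (xs @ [b]) = inversions xs + (if b = 0 then count_list xs 1 else 0)"
proof -
  define A where "A = {(j, j'). j < j' \<and> j' < length xs \<and> xs ! j = 1 \<and> xs ! j' = 0}"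
  define B where "B = (if b = 0 then {j. j < length xs \<and> xs ! j = 1} else {}) \<times> {length xs}"
  have eq: "{(j, j'). j < j' \<and> j' < length (xs @ [b]) \<and> (xs @ [b]) ! j = 1 \<and> (xs @ [b]) ! j' = 0}
      = A \<union> B"
    by (auto simp: A_def B_def nth_append less_Suc_eq)
  have "finite A"
    by (rule finite_subset[of _ "{..<length xs} \<times> {..<length xs}"]) (auto simp: A_def)
  moreover have "finite B" "A \<inter> B = {}"
    by (auto simp: A_def B_def)
  ultimately have "card (A \<union> B) = card A + card B"
    by (intro card_Un_disjoint) auto
  moreover have "card {j. j < length xs \<and> xs ! j = 1} = count_list xs 1"
    by (simp add: count_list_eq_length_filter length_filter_conv_card eq_commute)
  ultimately show ?thesis
    unfolding inversions_def eq by (simp add: A_def B_def card_cartesian_product)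
qed

text \<open>This is the Thue-Morse sequence with values 1 and -1.\<close>

definition ones_sign :: "nat \<Rightarrow> int" where
  "ones_sign n = (-1) ^ count_list (binary_digits n) 1"

text \<open>For \<open>n = 0\<close> the right-hand side would carry a leading zero, so the lemmas
  below treat that case separately.\<close>

lemma binary_digits_append:
  assumes "n \<ge> 1" "b < 2"
  shows "binary_digits (2 * n + b) = binary_digits n @ [b]"
  using assms by (subst binary_digits.simps) auto

lemma inv_sign_double: "inv_sign (2 * n) = inv_sign n * ones_sign n"
proof (cases "n = 0")
  case True
  then show ?thesis
    by (simp add: inv_sign_def ones_sign_def inv2_eq_inversions binary_digits.simps)
next
  case False
  then show ?thesis
    using binary_digits_append[of n 0]
    by (simp add: inv_sign_def ones_sign_def inv2_eq_inversions inversions_snoc power_add)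
qed

lemma inv_sign_Suc_double: "inv_sign (Suc (2 * n)) = inv_sign n"
proof (cases "n = 0")
  case True
  then show ?thesis
    by (simp add: inv_sign_def inv2_eq_inversions binary_digits.simps)
next
  case False
  then show ?thesis
    using binary_digits_append[of n 1]
    by (simp add: inv_sign_def inv2_eq_inversions inversions_snoc)
qed

lemma ones_sign_double: "ones_sign (2 * n) = ones_sign n"
  using binary_digits_append[of n 0] by (cases "n = 0") (simp_all add: ones_sign_def)

lemma ones_sign_Suc_double: "ones_sign (Suc (2 * n)) = - ones_sign n"
proof (cases "n = 0")
  case True
  then show ?thesis
    by (simp add: ones_sign_def binary_digits.simps)
next
  case False
  then show ?thesis
    using binary_digits_append[of n 1] by (simp add: ones_sign_def)
qed

lemma ones_sign_square: "ones_sign n * ones_sign n = 1"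
  by (simp add: ones_sign_def flip: power_mult_distrib)

text \<open>Appending 00 adds an even number of inversions and 11 adds none. Appending 10 adds one
  more than 01, so the two middle terms cancel.\<close>

lemma inv_sign_block:
  "inv_sign (4 * n) + inv_sign (4 * n + 1) + inv_sign (4 * n + 2) + inv_sign (4 * n + 3)
    = 2 * inv_sign n"
proof -
  have "inv_sign (4 * n) = inv_sign n"
    using inv_sign_double[of "2 * n"]
    by (simp add: inv_sign_double ones_sign_double mult.assoc ones_sign_square)
  moreover have "inv_sign (4 * n + 1) = inv_sign n * ones_sign n"
    using inv_sign_Suc_double[of "2 * n"] by (simp add: inv_sign_double)
  moreover have "inv_sign (4 * n + 2) = - (inv_sign n * ones_sign n)"
    using inv_sign_double[of "Suc (2 * n)"]
    by (simp add: inv_sign_Suc_double ones_sign_Suc_double)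
  moreover have "inv_sign (4 * n + 3) = inv_sign n"
    using inv_sign_Suc_double[of "Suc (2 * n)"]
    by (simp add: inv_sign_Suc_double numeral_3_eq_3)
  ultimately show ?thesis
    by simp
qed

section \<open>Partial sums and their exact scaling\<close>

definition T :: "nat \<Rightarrow> real" where
  "T N = (\<Sum>n<N. of_int (inv_sign n))"

lemma T_Suc: "T (Suc N) = T N + of_int (inv_sign N)"
  by (simp add: T_def)

lemma S_eq_T: "of_int (S N) = T N + of_int (inv_sign N)"
  unfolding S_def T_Suc[symmetric] by (simp add: T_def atLeast0AtMost lessThan_Suc_atMost)

text \<open>As the upper limit is excluded, the first \<open>4 * N\<close> terms split into exactly
  \<open>N\<close> full blocks of \<open>inv_sign_block\<close>.\<close>

lemma T_quadruple: "T (4 * N) = 2 * T N"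
proof (induction N)
  case 0
  then show ?case by (simp add: T_def)
next
  case (Suc N)
  have "T (4 * Suc N) = T (Suc (Suc (Suc (Suc (4 * N)))))"
    by (simp add: eval_nat_numeral)
  also have "\<dots> = T (4 * N) + of_int (inv_sign (4 * N) + inv_sign (4 * N + 1)
      + inv_sign (4 * N + 2) + inv_sign (4 * N + 3))"
    unfolding T_Suc by (simp add: eval_nat_numeral)
  also have "\<dots> = 2 * T (Suc N)"
    unfolding inv_sign_block by (simp add: Suc T_Suc)
  finally show ?case .
qed

lemma T_quadruple_power: "T (4 ^ k * N) = 2 ^ k * T N"
  by (induction k) (simp_all add: T_quadruple mult.assoc)

lemma abs_inv_sign: "\<bar>inv_sign n\<bar> = 1"
  by (simp add: inv_sign_def power_abs)

lemma T_lipschitz: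
  assumes "M \<le> N"
  shows "\<bar>T N - T M\<bar> \<le> real (N - M)"
  using assms
proof (induction N rule: dec_induct)
  case (step N)
  have "\<bar>of_int (inv_sign N)\<bar> = (1 :: real)"
    using abs_inv_sign[of N] by linarith
  then show ?case
    using step by (simp add: T_Suc Suc_diff_le)
qed simp

section \<open>The limit function and its continuity\<close>

definition approx :: "nat \<Rightarrow> real \<Rightarrow> real" where
  "approx k x = T (nat \<lfloor>4 ^ k * x\<rfloor>) / 2 ^ k"

text \<open>Since \<open>nat\<close> sends negative floors to 0 and \<open>T 0 = 0\<close>, this
  function vanishes on the negative reals.\<close>

definition F :: "real \<Rightarrow> real" where
  "F x = lim (\<lambda>k. approx k x)"

lemma approx_step: "\<bar>approx (Suc k) x - approx k x\<bar> \<le> 3 / 2 ^ Suc k"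
proof -
  define M where "M = nat \<lfloor>4 ^ k * x\<rfloor>"
  define N where "N = nat \<lfloor>4 ^ Suc k * x\<rfloor>"
  \<comment> \<open>Refining the grid adds one base-4 digit to the floor, hence the constant
    3.\<close>
  have "4 * \<lfloor>4 ^ k * x\<rfloor> \<le> \<lfloor>4 ^ Suc k * x\<rfloor>" "\<lfloor>4 ^ Suc k * x\<rfloor> \<le> 4 * \<lfloor>4 ^ k * x\<rfloor> + 3"
    by (simp_all add: floor_le_iff le_floor_iff mult.assoc) linarith+
  then have "4 * M \<le> N" "N - 4 * M \<le> 3"
    unfolding M_def N_def by linarith+
  then have "\<bar>T N - 2 * T M\<bar> \<le> 3"
    using T_lipschitz[of "4 * M" N] unfolding T_quadruple by linarith
  moreover have "approx (Suc k) x - approx k x = (T N - 2 * T M) / 2 ^ Suc k"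
    by (simp add: approx_def M_def N_def field_simps)
  ultimately show ?thesis
    by (simp add: divide_right_mono)
qed

text \<open>The steps are bounded by a geometric series. Keeping the exact tail difference on the
  right makes the induction telescope.\<close>

lemma approx_diff:
  assumes "k \<le> m"
  shows "\<bar>approx m x - approx k x\<bar> \<le> 3 / 2 ^ k - 3 / 2 ^ m"
  using assms
proof (induction m rule: dec_induct)
  case (step m)
  have "3 / 2 ^ m - 3 / 2 ^ Suc m = (3 / 2 ^ Suc m :: real)"
    by (simp add: field_simps)
  with step approx_step[of m x] show ?case
    by linarith
qed simp

lemma approx_tendsto_F: "(\<lambda>k. approx k x) \<longlonglongrightarrow> F x"
proof -
  have "Cauchy (\<lambda>k. approx k x)"
  proof (rule CauchyI')
    fix e :: real
    assume "e > 0"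
    then obtain k where k: "(1 / 2) ^ k < e / 3"
      using real_arch_pow_inv[of "e / 3" "1 / 2"] by auto
    have "dist (approx n x) (approx m x) < e" if "m \<ge> k" "m < n" for m n
    proof -
      have "dist (approx n x) (approx m x) \<le> 3 / 2 ^ m - 3 / 2 ^ n"
        using approx_diff[of m n x] that by (simp add: dist_real_def)
      also have "\<dots> \<le> 3 / 2 ^ m"
        by simp
      also have "\<dots> \<le> 3 / 2 ^ k"
        using that by (intro divide_left_mono power_increasing) auto
      also have "\<dots> < e"
        using k by (simp add: power_divide field_simps)
      finally show ?thesis .
    qed
    then show "\<exists>M. \<forall>m\<ge>M. \<forall>n>m. dist (approx m x) (approx n x) < e"
      by (metis dist_commute)
  qed
  then show ?thesis
    unfolding F_def by (simp only: Cauchy_convergent convergent_LIMSEQ_iff[symmetric])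
qed

text \<open>The bound does not depend on \<open>x\<close>: the convergence is uniform.\<close>

lemma F_approx: "\<bar>F x - approx k x\<bar> \<le> 3 / 2 ^ k"
proof (rule tendsto_upperbound)
  show "(\<lambda>m. \<bar>approx m x - approx k x\<bar>) \<longlonglongrightarrow> \<bar>F x - approx k x\<bar>"
    by (intro tendsto_intros approx_tendsto_F)
  show "\<forall>\<^sub>F m in sequentially. \<bar>approx m x - approx k x\<bar> \<le> 3 / 2 ^ k"
    using eventually_ge_at_top[of k]
  proof eventually_elim
    case (elim m)
    have "(0 :: real) \<le> 3 / 2 ^ m"
      by simp
    with approx_diff[OF elim, of x] show ?case
      by linarith
  qed
qed simp

lemma F_of_nat: "F (real N) = T N"
proof -
  have "nat \<lfloor>4 ^ k * real N\<rfloor> = 4 ^ k * N" for k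
    by (metis floor_of_nat nat_int of_nat_mult of_nat_numeral of_nat_power)
  then have "approx k (real N) = T N" for k
    by (simp add: approx_def T_quadruple_power)
  then show ?thesis
    using approx_tendsto_F[of "real N"] by (simp add: LIMSEQ_const_iff)
qed

text \<open>Quadrupling the argument shifts the index of the approximation by one and doubles its
  value.\<close>

lemma F_quadruple: "F (4 * x) = 2 * F x"
proof (rule LIMSEQ_unique)
  have "approx k (4 * x) = 2 * approx (Suc k) x" for k
    by (simp add: approx_def mult_ac)
  then show "(\<lambda>k. approx k (4 * x)) \<longlonglongrightarrow> 2 * F x"
    using tendsto_mult_left[OF LIMSEQ_Suc[OF approx_tendsto_F[of x]], of 2] by simp
qed (rule approx_tendsto_F)

lemma F_scale: "F (4 ^ k * x) = 2 ^ k * F x"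
  by (induction k) (simp_all add: F_quadruple mult.assoc)

text \<open>This is Hoelder continuity with exponent 1/2. The 7 is 3 + 1 + 3: two approximation
  errors, and one for the two floors, which differ by at most 1.\<close>

lemma F_modulus:
  assumes "\<bar>x - y\<bar> \<le> 1 / 4 ^ k"
  shows "\<bar>F x - F y\<bar> \<le> 7 / 2 ^ k"
  using assms
proof (induction x y rule: linorder_wlog)
  case (le x y)
  define M where "M = nat \<lfloor>4 ^ k * x\<rfloor>"
  define N where "N = nat \<lfloor>4 ^ k * y\<rfloor>"
  have "4 ^ k * x \<le> 4 ^ k * y" "4 ^ k * y \<le> 4 ^ k * x + 1"
    using le by (simp_all add: field_simps)
  then have "\<lfloor>4 ^ k * x\<rfloor> \<le> \<lfloor>4 ^ k * y\<rfloor>" "\<lfloor>4 ^ k * y\<rfloor> \<le> \<lfloor>4 ^ k * x\<rfloor> + 1"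
    by linarith+
  then have "M \<le> N" "N - M \<le> 1"
    unfolding M_def N_def by linarith+
  then have "\<bar>T N - T M\<bar> \<le> 1"
    using T_lipschitz[of M N] by linarith
  then have "\<bar>(T N - T M) / 2 ^ k\<bar> \<le> 1 / 2 ^ k"
    by (simp add: divide_right_mono)
  then have "\<bar>approx k y - approx k x\<bar> \<le> 1 / 2 ^ k"
    by (simp add: approx_def M_def N_def diff_divide_distrib)
  with F_approx[of x k] F_approx[of y k] show ?case
    by linarith
next
  case (sym x y)
  then show ?case by (simp add: abs_minus_commute)
qed

lemma continuous_on_F: "continuous_on A F"
proof (rule continuous_onI)
  fix x e :: real
  assume "e > 0"
  then obtain k where k: "(1 / 2) ^ k < e / 7"
    using real_arch_pow_inv[of "e / 7" "1 / 2"] by auto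
  have "dist (F y) (F x) \<le> e" if "dist y x < 1 / 4 ^ k" for y
  proof -
    have "\<bar>F y - F x\<bar> \<le> 7 / 2 ^ k"
      using that by (intro F_modulus) (simp add: dist_real_def)
    also have "\<dots> < e"
      using k by (simp add: power_divide field_simps)
    finally show ?thesis
      by (simp add: dist_real_def)
  qed
  then show "\<exists>d>0. \<forall>y\<in>A. dist y x < d \<longrightarrow> dist (F y) (F x) \<le> e"
    by (intro exI[of _ "1 / 4 ^ k"]) simp
qed

section \<open>Failure of differentiability on the 4-adic grid\<close>

lemma F_increment: "\<bar>F (real (Suc n) / 4 ^ k) - F (real n / 4 ^ k)\<bar> = 1 / 2 ^ k"
proof -
  \<comment> \<open>Scaling by \<open>4 ^ k\<close> turns neighbouring grid points into consecutive
    integers, between which \<open>T\<close> changes by a single sign.\<close>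
  have "T m = 2 ^ k * F (real m / 4 ^ k)" for m
    using F_scale[of k "real m / 4 ^ k"] by (simp add: F_of_nat)
  then have "2 ^ k * (F (real (Suc n) / 4 ^ k) - F (real n / 4 ^ k)) = of_int (inv_sign n)"
    using T_Suc[of n] by (simp add: right_diff_distrib del: of_nat_Suc)
  then have "2 ^ k * \<bar>F (real (Suc n) / 4 ^ k) - F (real n / 4 ^ k)\<bar> = \<bar>of_int (inv_sign n)\<bar>"
    by (metis abs_mult abs_numeral power_abs)
  also have "\<dots> = 1"
    using abs_inv_sign[of n] by linarith
  finally show ?thesis
    by (simp add: field_simps)
qed

lemma F_not_differentiable:
  assumes "x \<ge> 0"
  shows "\<not> F differentiable (at x)"
proof
  assume "F differentiable (at x)"
  then obtain D where "(F has_derivative (\<lambda>h. D * h)) (at x)"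
    by (metis has_field_derivative_def real_differentiable_def)
  \<comment> \<open>The definition of the derivative is used with tolerance 1.\<close>
  then obtain d where "d > 0"
    and d: "\<And>y. \<bar>y - x\<bar> < d \<Longrightarrow> \<bar>F y - F x - D * (y - x)\<bar> \<le> \<bar>y - x\<bar>"
    unfolding has_derivative_at_alt by (metis mult_1 real_norm_def zero_less_one)
  obtain i where i: "(1 / 4) ^ i < d"
    using real_arch_pow_inv[OF \<open>d > 0\<close>, of "1 / 4"] by auto
  obtain j where j: "\<bar>D\<bar> + 1 < 2 ^ j"
    using real_arch_pow[of 2 "\<bar>D\<bar> + 1"] by auto
  define k where "k = max i j"
  define h :: real where "h = 1 / 4 ^ k"
  have "h \<le> (1 / 4) ^ i"
    unfolding h_def k_def power_one_over[symmetric] by (intro power_decreasing) auto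
  then have h: "h > 0" "h < d"
    using i by (simp_all add: h_def)
  have "(2 :: real) ^ j \<le> 2 ^ k"
    by (simp add: k_def)
  then have k: "\<bar>D\<bar> + 1 < 2 ^ k"
    using j by linarith
  \<comment> \<open>The grid interval from \<open>a\<close> to \<open>b\<close> has width
    \<open>h < d\<close> and contains \<open>x\<close>; nonnegativity of \<open>x\<close> makes
    \<open>n\<close> the true floor.\<close>
  define n where "n = nat \<lfloor>4 ^ k * x\<rfloor>"
  define a where "a = real n / 4 ^ k"
  define b where "b = real (Suc n) / 4 ^ k"
  have "real n \<le> 4 ^ k * x" "4 ^ k * x \<le> real n + 1"
    unfolding n_def using assms by (simp_all add: of_nat_nat)
  then have "a \<le> x" "x \<le> b" "b = a + h"
    by (simp_all add: a_def b_def h_def field_simps)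
  \<comment> \<open>The linearization errors at \<open>a\<close> and \<open>b\<close> are at most
    \<open>x - a\<close> and \<open>b - x\<close>, which add up to \<open>h\<close>.\<close>
  then have "\<bar>F b - F a - D * h\<bar> \<le> h"
    using d[of a] d[of b] h by (simp add: algebra_simps)
  moreover have "\<bar>F b - F a\<bar> = 1 / 2 ^ k"
    unfolding a_def b_def by (rule F_increment)
  ultimately have "1 / 2 ^ k \<le> \<bar>D * h\<bar> + h"
    by linarith
  also have "\<dots> = (\<bar>D\<bar> + 1) * h"
    using h by (simp add: abs_mult algebra_simps)
  also have "\<dots> < 2 ^ k * h"
    using k h by (intro mult_strict_right_mono)
  also have "\<dots> = 1 / 2 ^ k"
    by (simp add: h_def field_simps flip: power_mult_distrib)
  finally show False
    by simp
qed

section \<open>The periodic function\<close>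

lemma bounded_range_periodic:
  fixes G :: "real \<Rightarrow> 'a :: metric_space"
  assumes cont: "continuous_on UNIV G" and per: "\<And>x. G (x + 1) = G x"
  shows "bounded (range G)"
proof -
  interpret periodic_fun_simple' G
    by standard (rule per)
  \<comment> \<open>Reduction to the fractional part confines all values to the image of a compact
    interval.\<close>
  have "G x \<in> G ` {0..1}" for x
  proof -
    have "G x = G (frac x)"
      using minus_of_int[of x "\<lfloor>x\<rfloor>"] by (simp add: frac_def)
    moreover have "frac x \<in> {0..1}"
      by (simp add: frac_ge_0 less_imp_le frac_lt_1)
    ultimately show ?thesis
      by blast
  qed
  then have "range G \<subseteq> G ` {0..1}"
    by blast
  moreover have "bounded (G ` {0..1})"
    by (intro compact_imp_bounded compact_continuous_image continuous_on_subset[OF cont]) auto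
  ultimately show ?thesis
    by (rule bounded_subset[rotated])
qed

theorem theorem2:
  shows "\<exists>G :: real \<Rightarrow> real.
           bounded (range G) \<and>
           continuous_on UNIV G \<and>
           (\<forall>x. \<not> G differentiable (at x)) \<and>
           (\<forall>x. G (x + 1) = G x) \<and>
           (\<forall>N\<ge>1. real_of_int (S N) = sqrt (real N) * G (log 4 (real N)) + real_of_int (inv_sign N))"
proof -
  \<comment> \<open>The divisor \<open>2 powr y\<close> is the square root of
    \<open>4 powr y\<close>, so by \<open>F_quadruple\<close> numerator and denominator both double
    when \<open>y\<close> grows by 1.\<close>
  define G where "G y = F (4 powr y) / 2 powr y" for y :: real
  have cont: "continuous_on UNIV G"
    unfolding G_def
    by (intro continuous_intros continuous_on_compose2[OF continuous_on_F[of UNIV]]) auto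
  have per: "G (x + 1) = G x" for x
    using F_quadruple[of "4 powr x"] by (simp add: G_def powr_add mult.commute)
  have F_G: "F x = sqrt x * G (log 4 x)" if "x > 0" for x
  proof -
    have "sqrt x = 2 powr log 4 x"
    proof -
      have "2 powr log 4 x = (4 powr (1 / 2)) powr log 4 x"
        by (simp add: powr_half_sqrt)
      also have "\<dots> = (4 powr log 4 x) powr (1 / 2)"
        by (simp add: powr_powr mult.commute)
      finally show ?thesis
        using that by (simp add: powr_half_sqrt)
    qed
    then show ?thesis
      using that by (simp add: G_def)
  qed
  have nondiff: "\<not> G differentiable (at y)" for y
  proof
    assume "G differentiable (at y)"
    then obtain D where D: "(G has_real_derivative D) (at y)"
      by (auto simp: real_differentiable_def)
    define x :: real where "x = 4 powr y"
    have x: "x > 0" "log 4 x = y"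
      by (simp_all add: x_def)
    \<comment> \<open>A derivative of \<open>G\<close> at \<open>y\<close> would pass to
      \<open>F\<close> at \<open>4 powr y\<close> through the formula \<open>F_G\<close>.\<close>
    have "((\<lambda>x. sqrt x * G (log 4 x)) has_real_derivative
        sqrt x * (D * (1 / (ln 4 * x))) + inverse (sqrt x) / 2 * G (log 4 x)) (at x)"
      using x D by (auto intro!: derivative_eq_intros DERIV_chain2[of G] simp: field_simps)
    then have "(F has_real_derivative
        sqrt x * (D * (1 / (ln 4 * x))) + inverse (sqrt x) / 2 * G (log 4 x)) (at x)"
      \<comment> \<open>\<open>F_G\<close> holds only for positive arguments, but these form an open
        set containing \<open>x\<close>.\<close>
      by (rule has_field_derivative_transform_within_open[of _ _ _ "{0<..}"]) (auto simp: x F_G)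
    then show False
      using F_not_differentiable[of x] x by (auto simp: real_differentiable_def)
  qed
  have "real_of_int (S N) = sqrt (real N) * G (log 4 (real N)) + real_of_int (inv_sign N)"
    if "N \<ge> 1" for N
    using F_G[of "real N"] that by (simp add: S_eq_T F_of_nat)
  then show ?thesis
    using bounded_range_periodic[OF cont per] cont nondiff per by blast
qed

end
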